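(* Consider the SPIDeC discrete equations (defined in the context) with $M+1$ stages, $N_k$ correction sweeps and stepsize $h$, and assume that the initial values $y_i^0=y_i(0)$ are positive for each $i=1,\dots,N$. Then, independently of the stepsize $h>0$, the relations $$y^{n,m}_{i(k)}>0,\qquad y_i^n>0,\qquad \text{for all } i=1,\dots,N,\ m=0,\dots,M,\ k=0,\dots,N_k,$$ hold for each $n=0,\dots,N_t$.
   Context: Let $\mathbb{R}^N_+=\{\bm\eta\in\mathbb{R}^N:\eta_i>0\ \forall i=1,\dots,N\}$. Consider the initial value problem $\bm y'(t)=\bm f(\bm y(t))$, $t\in[0,T]$, $\bm y(0)=\bm y_0\in\mathbb{R}^N_+$, where $\bm f=[f_1,\dots,f_N]^\top$ is a sufficiently smooth $\mathbb{R}^N$-valued function defined on an open set containing $\mathbb{R}^N_+$. Standing assumption: $\mathbb{R}^N_+$ is forward invariant under the flow, so solutions starting in $\mathbb{R}^N_+$ stay in $\mathbb{R}^N_+$ for all $t\in[0,T]$. Let $t_n=nh$, $n=0,\dots,N_t$, be a uniform partition of $[0,T]$ with stepsize $h>0$. Let $M\ge0$, $N_k\ge 0$ be integers, and let $0\le\tau_0<\tau_1<\dots<\tau_M=1$ be quadrature nodes with Lagrange basis polynomials $\ell_0,\dots,\ell_M$ (of degree at most $M$, $\ell_j(\tau_l)=\delta_{jl}$). Set $Q_{m,j}=\int_0^{\tau_m}\ell_j(\tau)\,d\tau$ for $m,j=0,\dots,M$. The SPIDeC scheme with $M+1$ stages and $N_k$ correction sweeps is, component-wise for $i=1,\dots,N$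 and $m=0,\dots,M$, starting from $y_i^0=y_i(0)$: $$y^{n,m}_{i(0)}=y_i^n\exp\Big(h\tau_m\frac{f_i(\bm y^n)}{y_i^n}\Big),\qquad n=0,\dots,N_t,$$ $$y^{n,m}_{i(k)}=y_i^n\exp\Big(h\sum_{j=0}^M Q_{m,j}\frac{f_i(\bm y^{n,j}_{(k-1)})}{y^{n,j}_{i(k-1)}}\Big),\qquad k=1,\dots,N_k,\ n=0,\dots,N_t,$$ $$y_i^{n+1}=y^{n,M}_{i(N_k)},\qquad n=0,\dots,N_t-1.$$ *)

theory Defs
  imports "HOL-Analysis.Analysis" "HOL-Computational_Algebra.Polynomial"
begin

section \<open>The initial value problem\<close>

definition positive_orthant :: "(real ^ 'n::finite) set" where
  "positive_orthant = {\<eta>. \<forall>i. 0 < \<eta> $ i}"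

definition C1_on :: "(real ^ 'n::finite) set \<Rightarrow> (real ^ 'n \<Rightarrow> real ^ 'n) \<Rightarrow> bool" where
  "C1_on D f \<longleftrightarrow>
     (\<exists>f'. (\<forall>x\<in>D. (f has_derivative blinfun_apply (f' x)) (at x)) \<and> continuous_on D f')"

text \<open>The field \<open>f\<close> is only meaningful on its domain \<open>D\<close>, so a solution has to stay in \<open>D\<close>.\<close>

definition solves_ivp ::
  "(real ^ 'n::finite \<Rightarrow> real ^ 'n) \<Rightarrow> (real ^ 'n) set \<Rightarrow> real \<Rightarrow> real ^ 'n \<Rightarrow> (real \<Rightarrow> real ^ 'n) \<Rightarrow> bool"
where
  "solves_ivp f D T y0 y \<longleftrightarrow> y 0 = y0 \<and>
     (\<forall>t\<in>{0..T}. y t \<in> D \<and> (y has_vector_derivative f (y t)) (at t within {0..T}))"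

definition forward_invariant ::
  "(real ^ 'n::finite \<Rightarrow> real ^ 'n) \<Rightarrow> (real ^ 'n) set \<Rightarrow> real \<Rightarrow> (real ^ 'n) set \<Rightarrow> bool"
where
  "forward_invariant f D T S \<longleftrightarrow>
     (\<forall>x\<in>S. \<forall>y. solves_ivp f D T x y \<longrightarrow> (\<forall>t\<in>{0..T}. y t \<in> S))"

section \<open>Quadrature\<close>

definition quadrature_nodes :: "nat \<Rightarrow> (nat \<Rightarrow> real) \<Rightarrow> bool" where
  "quadrature_nodes M \<tau> \<longleftrightarrow> 0 \<le> \<tau> 0 \<and> strict_mono_on {0..M} \<tau> \<and> \<tau> M = 1"

definition lagrange_basis :: "nat \<Rightarrow> (nat \<Rightarrow> real) \<Rightarrow> nat \<Rightarrow> real poly" where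
  "lagrange_basis M \<tau> j = (\<Prod>l\<in>{0..M} - {j}. smult (1 / (\<tau> j - \<tau> l)) [:- \<tau> l, 1:])"

lemma degree_lagrange_basis:
  assumes "j \<le> M"
  shows "degree (lagrange_basis M \<tau> j) \<le> M"
proof -
  have "degree (lagrange_basis M \<tau> j)
      \<le> (\<Sum>l\<in>{0..M} - {j}. degree (smult (1 / (\<tau> j - \<tau> l)) [:- \<tau> l, 1:]))"
    unfolding lagrange_basis_def
    by (rule order_trans[OF degree_prod_sum_le]) (simp_all add: o_def del: smult_pCons)
  also have "\<dots> \<le> (\<Sum>l\<in>{0..M} - {j}. 1)"
    by (rule sum_mono) simp
  also have "\<dots> = M"
    using assms by simp
  finally show ?thesis .
qed

lemma poly_lagrange_basis_node:
  assumes "inj_on \<tau> {0..M}" "j \<le> M" "l \<le> M"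
  shows "poly (lagrange_basis M \<tau> j) (\<tau> l) = (if j = l then 1 else 0)"
proof (cases "j = l")
  case True
  have "\<tau> l \<noteq> \<tau> k" if "k \<in> {0..M} - {l}" for k
    using assms(1,3) that by (auto dest: inj_onD)
  with True show ?thesis
    by (auto simp: lagrange_basis_def poly_prod intro!: prod.neutral simp: divide_simps)
next
  case False
  with assms(3) show ?thesis
    by (auto simp: lagrange_basis_def poly_prod intro!: prod_zero bexI[of _ l])
qed

definition quadrature_weight :: "nat \<Rightarrow> (nat \<Rightarrow> real) \<Rightarrow> nat \<Rightarrow> nat \<Rightarrow> real" where
  "quadrature_weight M \<tau> m j = integral {0..\<tau> m} (poly (lagrange_basis M \<tau> j))"

section \<open>The SPIDeC scheme\<close>

text \<open>
  \<open>y n\<close> is the approximation at time \<open>n * h\<close>, and \<open>Y k n m\<close> is the value at stage \<open>m\<close>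
  of step \<open>n\<close> after \<open>k\<close> correction sweeps.
\<close>

definition spidec ::
  "(real ^ 'n::finite \<Rightarrow> real ^ 'n) \<Rightarrow> real \<Rightarrow> nat \<Rightarrow> (nat \<Rightarrow> real) \<Rightarrow> nat \<Rightarrow> nat \<Rightarrow> real ^ 'n \<Rightarrow>
   (nat \<Rightarrow> real ^ 'n) \<Rightarrow> (nat \<Rightarrow> nat \<Rightarrow> nat \<Rightarrow> real ^ 'n) \<Rightarrow> bool"
where
  "spidec f h M \<tau> N\<^sub>k N\<^sub>t y0 y Y \<longleftrightarrow>
     y 0 = y0 \<and>
     (\<forall>n\<in>{0..N\<^sub>t}. \<forall>m\<in>{0..M}. \<forall>i.
        Y 0 n m $ i = y n $ i * exp (h * \<tau> m * (f (y n) $ i / y n $ i))) \<and>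
     (\<forall>k\<in>{1..N\<^sub>k}. \<forall>n\<in>{0..N\<^sub>t}. \<forall>m\<in>{0..M}. \<forall>i.
        Y k n m $ i = y n $ i *
          exp (h * (\<Sum>j=0..M. quadrature_weight M \<tau> m j *
                      (f (Y (k - 1) n j) $ i / Y (k - 1) n j $ i)))) \<and>
     (\<forall>n\<in>{0..<N\<^sub>t}. \<forall>i. y (n + 1) $ i = Y N\<^sub>k n M $ i)"

text \<open>The scheme is explicit, so the equations have a solution for all data.\<close>

lemma spidec_exists:
  fixes f :: "real ^ 'n::finite \<Rightarrow> real ^ 'n"
  shows "\<exists>y Y. spidec f h M \<tau> N\<^sub>k N\<^sub>t y0 y Y"
proof -
  define S :: "real ^ 'n \<Rightarrow> nat \<Rightarrow> nat \<Rightarrow> real ^ 'n" where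
    "S = (\<lambda>v. rec_nat (\<lambda>m. \<chi> i. v $ i * exp (h * \<tau> m * (f v $ i / v $ i)))
       (\<lambda>_ P m. \<chi> i. v $ i * exp (h * (\<Sum>j=0..M. quadrature_weight M \<tau> m j *
          (f (P j) $ i / P j $ i)))))"
  define y where "y = rec_nat y0 (\<lambda>_ v. S v N\<^sub>k M)"
  have "spidec f h M \<tau> N\<^sub>k N\<^sub>t y0 y (\<lambda>k n. S (y n) k)"
    unfolding spidec_def
  proof (intro conjI ballI allI)
    fix k n m i
    assume "k \<in> {1..N\<^sub>k}"
    then obtain k' where k: "k = Suc k'"
      by (cases k) auto
    show "S (y n) k m $ i = y n $ i *
          exp (h * (\<Sum>j=0..M. quadrature_weight M \<tau> m j *
                      (f (S (y n) (k - 1) j) $ i / S (y n) (k - 1) j $ i)))"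
      by (simp add: k S_def)
  qed (simp_all add: y_def S_def)
  then show ?thesis
    by blast
qed

end

theory Submission
  imports Defs
begin

text \<open>
  Every stage value of a time step, from the predictor and from each correction sweep, is the
  value \<open>y n\<close> at the start of that step, multiplied componentwise by an exponential.
  A real exponential is positive whatever its argument, so a stage value has the sign of
  \<open>y n\<close>: neither the size of \<open>h\<close>, nor the signs of the quadrature weights, nor
  the values of \<open>f\<close> can change it (\<open>spidec_stage_pos\<close>). The next value
  \<open>y (n + 1)\<close> is itself the last stage of the last sweep, so positivity propagates
  from \<open>y0\<close> by induction on the time step (\<open>spidec_step_pos\<close>).
\<close>

text \<open>
  The sweeps need no induction: each of them restarts from \<open>y n\<close>, and the previous sweep
  enters only through the exponent.
\<close>

lemma spidec_stage_pos:
  assumes "spidec f h M \<tau> N\<^sub>k N\<^sub>t y0 y Y"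
    and "n \<le> N\<^sub>t" "m \<le> M" "k \<le> N\<^sub>k" and "0 < y n $ i"
  shows "0 < Y k n m $ i"
proof -
  have step: "n \<in> {0..N\<^sub>t}" "m \<in> {0..M}"
    using assms(2,3) by simp_all
  show ?thesis
  proof (cases "k = 0")
    case True
    have "Y 0 n m $ i = y n $ i * exp (h * \<tau> m * (f (y n) $ i / y n $ i))"
      using assms(1) step unfolding spidec_def by blast
    with True assms(5) show ?thesis
      by simp
  next
    case False
    with assms(4) have "k \<in> {1..N\<^sub>k}"
      by simp
    with assms(1) step have "Y k n m $ i = y n $ i *
        exp (h * (\<Sum>j=0..M. quadrature_weight M \<tau> m j *
                    (f (Y (k - 1) n j) $ i / Y (k - 1) n j $ i)))"
      unfolding spidec_def by blast
    with assms(5) show ?thesis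
      by simp
  qed
qed

lemma spidec_step_pos:
  assumes "spidec f h M \<tau> N\<^sub>k N\<^sub>t y0 y Y" and "n \<le> N\<^sub>t" and "0 < y0 $ i"
  shows "0 < y n $ i"
  using assms(2)
proof (induction n)
  case 0
  show ?case
    using assms(1,3) unfolding spidec_def by blast
next
  case (Suc n)
  have "n \<in> {0..<N\<^sub>t}"
    using Suc.prems by simp
  then have "y (n + 1) $ i = Y N\<^sub>k n M $ i"
    using assms(1) unfolding spidec_def by blast
  moreover have "0 < Y N\<^sub>k n M $ i"
    using spidec_stage_pos[OF assms(1)] Suc by simp
  ultimately show ?case
    by simp
qed

theorem theorem3p1:
  fixes f :: "real ^ 'n::finite \<Rightarrow> real ^ 'n"
    and D :: "(real ^ 'n) set"
    and T h :: real
    and y0 :: "real ^ 'n"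
    and \<tau> :: "nat \<Rightarrow> real"
    and M N\<^sub>k N\<^sub>t :: nat
    and y :: "nat \<Rightarrow> real ^ 'n"
    and Y :: "nat \<Rightarrow> nat \<Rightarrow> nat \<Rightarrow> real ^ 'n"
  assumes "open D" and "positive_orthant \<subseteq> D" and "C1_on D f"
    and "0 < T" and "forward_invariant f D T positive_orthant"
    and "0 < h" and "T = real N\<^sub>t * h"
    and "quadrature_nodes M \<tau>"
    and "y0 \<in> positive_orthant"
    and "spidec f h M \<tau> N\<^sub>k N\<^sub>t y0 y Y"
  shows "\<forall>n\<in>{0..N\<^sub>t}. \<forall>i. \<forall>m\<in>{0..M}. \<forall>k\<in>{0..N\<^sub>k}. 0 < Y k n m $ i \<and> 0 < y n $ i"
proof (intro ballI allI)
  fix n i m k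
  assume "n \<in> {0..N\<^sub>t}" "m \<in> {0..M}" "k \<in> {0..N\<^sub>k}"
  then have bounds: "n \<le> N\<^sub>t" "m \<le> M" "k \<le> N\<^sub>k"
    by simp_all
  have "0 < y0 $ i"
    using \<open>y0 \<in> positive_orthant\<close> by (simp add: positive_orthant_def)
  then have "0 < y n $ i"
    by (rule spidec_step_pos[OF \<open>spidec f h M \<tau> N\<^sub>k N\<^sub>t y0 y Y\<close> bounds(1)])
  then show "0 < Y k n m $ i \<and> 0 < y n $ i"
    using spidec_stage_pos[OF \<open>spidec f h M \<tau> N\<^sub>k N\<^sub>t y0 y Y\<close> bounds] by simp
qed

end
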